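(* If $X$ is an infinite-dimensional strictly convex Banach space, then the unit sphere of $X$ contains a symmetrically $(1+)$-separated subset with cardinality $w^*\text{-}\mathrm{dens}\, X^*$.
   Context: Banach spaces are over the real or the complex field. $w^*\text{-}\mathrm{dens}\,X^*$ is the density character of $X^*$ in the $w^*$-topology. A subset $A$ of a normed space is symmetrically $(1+)$-separated if $\|x-y\|>1$ and $\|x+y\|>1$ for all distinct $x,y\in A$. *)

theory Defs
  imports "HOL-Analysis.Analysis"
begin

unbundle cardinal_syntax

text \<open>A Banach space over a scalar field \<open>'k\<close> (used with \<open>'k = real\<close> and \<open>'k = complex\<close>)
  is given by a type of class \<^class>\<open>banach\<close>, which supplies addition, norm and completeness,
  together with a scalar multiplication by \<open>'k\<close> that is compatible with the norm and extends the
  real scalar multiplication of the class.\<close>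

locale banach_space_over = vector_space sc
  for sc :: "'k::real_normed_field \<Rightarrow> 'a::banach \<Rightarrow> 'a" +
  assumes norm_scale: "norm (sc c x) = norm c * norm x"
    and scale_of_real: "sc (of_real r) x = r *\<^sub>R x"

lemma banach_space_over_scaleR:
  "banach_space_over (scaleR :: real \<Rightarrow> 'a::banach \<Rightarrow> 'a)"
  by unfold_locales (auto simp: algebra_simps)

lemma banach_space_over_complex:
  "banach_space_over ((*) :: complex \<Rightarrow> complex \<Rightarrow> complex)"
  by unfold_locales (auto simp: algebra_simps norm_mult scaleR_conv_of_real)

definition infinite_dimensional ::
  "('k::real_normed_field \<Rightarrow> 'a::banach \<Rightarrow> 'a) \<Rightarrow> bool" where
  "infinite_dimensional sc \<longleftrightarrow> \<not> (\<exists>B. finite B \<and> module.span sc B = UNIV)"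

definition strictly_convex_space :: "'a::real_normed_vector itself \<Rightarrow> bool" where
  "strictly_convex_space _ \<longleftrightarrow>
     (\<forall>x y :: 'a. norm x = 1 \<and> norm y = 1 \<and> x \<noteq> y \<longrightarrow> norm ((1/2) *\<^sub>R (x + y)) < 1)"

definition continuous_dual ::
  "('k::real_normed_field \<Rightarrow> 'a::banach \<Rightarrow> 'a) \<Rightarrow> ('a \<Rightarrow> 'k) set" where
  "continuous_dual sc = {f. Vector_Spaces.linear sc (*) f \<and> continuous_on UNIV f}"

text \<open>The \<open>w\<^sup>*\<close>-topology, the coarsest one making all evaluations continuous, is the
  topology of pointwise convergence.\<close>

definition weak_star_topology ::
  "('k::real_normed_field \<Rightarrow> 'a::banach \<Rightarrow> 'a) \<Rightarrow> ('a \<Rightarrow> 'k) topology" where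
  "weak_star_topology sc =
     subtopology (product_topology (\<lambda>_. euclidean) UNIV) (continuous_dual sc)"

definition dense_subset_of :: "'b topology \<Rightarrow> 'b set \<Rightarrow> bool" where
  "dense_subset_of T D \<longleftrightarrow> D \<subseteq> topspace T \<and> T closure_of D = topspace T"

text \<open>The least cardinality of a dense subset, as a cardinal \<open>|D|\<close>.  The choice is
  well defined up to \<open>=o\<close>, since cardinals are well-ordered.\<close>

definition density_character :: "'b topology \<Rightarrow> 'b rel" where
  "density_character T =
     |SOME D. dense_subset_of T D \<and> (\<forall>D'. dense_subset_of T D' \<longrightarrow> |D| \<le>o |D'| )|"

definition symmetrically_one_plus_separated :: "'a::real_normed_vector set \<Rightarrow> bool" where
  "symmetrically_one_plus_separated A \<longleftrightarrow>
     (\<forall>x\<in>A. \<forall>y\<in>A. x \<noteq> y \<longrightarrow> norm (x - y) > 1 \<and> norm (x + y) > 1)"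

lemma density_character_witness:
  obtains D where "dense_subset_of T D" "density_character T = |D|"
    "\<And>D'. dense_subset_of T D' \<Longrightarrow> |D| \<le>o |D'|"
proof -
  let ?R = "card_of ` Collect (dense_subset_of T)"
  have "dense_subset_of T (topspace T)"
    by (simp add: dense_subset_of_def)
  then have ne: "?R \<noteq> {}" by blast
  have co: "\<forall>r\<in>?R. Card_order r"
    by (simp add: card_of_Card_order)
  have "\<exists>r\<in>?R. \<forall>r'\<in>?R. r \<le>o r'"
    by (rule exists_minim_Card_order[OF ne co])
  then have ex: "\<exists>D. dense_subset_of T D \<and> (\<forall>D'. dense_subset_of T D' \<longrightarrow> |D| \<le>o |D'| )"
    by simp
  show thesis
    by (rule that[OF _ density_character_def]) (use someI_ex[OF ex] in blast)+
qed

end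

theory Submission
  imports Defs
begin

text \<open>
Let \<open>D\<close> be a \<open>w\<^sup>*\<close>-dense subset of the dual of least cardinality, well-ordered in type \<open>|D|\<close>.  By
transfinite recursion one chooses unit vectors \<open>x\<^sub>d\<close> together with functionals \<open>g\<^sub>d\<close> that norm
them, each \<open>x\<^sub>d\<close> in the common kernel of all earlier \<open>g\<^sub>e\<close>.

Why the recursion does not stop: fewer than \<open>|D|\<close> functionals always have a common zero \<open>y \<noteq> 0\<close>
(\<open>few_functionals_common_zero\<close>).  For finitely many, a trivial common kernel would make the space
finite-dimensional.  For an infinite family \<open>F\<close> with trivial common kernel, linear combinations of
\<open>F\<close> interpolate any given functional on any finite set of vectors
(\<open>separating_combination_interpolates\<close>), so the combinations whose coefficients lie in a countable
dense set of scalars are \<open>w\<^sup>*\<close>-dense (\<open>weak_star_dense_combinations\<close>); there are only \<open>|F|\<close> of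
them, which contradicts the minimality of \<open>|D|\<close>.

Why the vectors are separated: if \<open>e\<close> precedes \<open>d\<close> and \<open>f\<close> is the real part of \<open>g\<^sub>e\<close>, then
\<open>f (x\<^sub>e \<plusminus> x\<^sub>d) = f x\<^sub>e = 1\<close>, whence \<open>\<parallel>x\<^sub>e \<plusminus> x\<^sub>d\<parallel> \<ge> 1\<close>.  Equality is impossible: \<open>f\<close> would equal
\<open>1\<close> at two different unit vectors \<open>x\<^sub>e\<close> and \<open>x\<^sub>e \<plusminus> x\<^sub>d\<close>, hence at their midpoint, whose norm is
less than \<open>1\<close> by strict convexity (\<open>norm_gt_one_of_norming_functional\<close>).

Norming functionals come from the Hahn--Banach theorem, proved here by the minimal sublinear
functional argument; over the complex field a real functional \<open>f\<close> is the real part of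
\<open>z \<mapsto> f z - i f (i z)\<close>, and this is why the recursion only asks that zeros of \<open>g\<close> be zeros of \<open>f\<close>.
\<close>

section \<open>Minimal sublinear functionals and norming functionals\<close>

definition sublinear :: "('a::real_vector \<Rightarrow> real) \<Rightarrow> bool" where
  "sublinear p \<longleftrightarrow>
     (\<forall>x y. p (x + y) \<le> p x + p y) \<and> (\<forall>c\<ge>0. \<forall>x. p (c *\<^sub>R x) = c * p x)"

lemma sublinear_zero: "sublinear p \<Longrightarrow> p 0 = 0"
  unfolding sublinear_def by (metis mult_zero_left order_refl scaleR_zero_left)

lemma sublinear_lower_bound:
  assumes "sublinear p"
  shows "- p (- y) \<le> p y"
proof -
  have "p (y + - y) \<le> p y + p (- y)"
    using assms unfolding sublinear_def by blast
  then show ?thesis using sublinear_zero[OF assms] by simp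
qed

text \<open>Applying the hypothesis with \<open>1/c\<close> in place of \<open>c\<close> gives the opposite inequality.  For an infimum
of sublinear functionals the assumed half is the one that is immediate.\<close>

lemma sublinear_from_half_homogeneity:
  assumes add: "\<And>x y. q (x + y) \<le> q x + q y"
    and zero: "q 0 = (0::real)"
    and scale: "\<And>c x. c > 0 \<Longrightarrow> q (c *\<^sub>R x) \<le> c * q x"
  shows "sublinear q"
  unfolding sublinear_def
proof (intro conjI allI impI add)
  fix c :: real and x assume "0 \<le> c"
  show "q (c *\<^sub>R x) = c * q x"
  proof (cases "c = 0")
    case True then show ?thesis by (simp add: zero)
  next
    case False
    with \<open>0 \<le> c\<close> have c: "c > 0" by simp
    have "q ((1/c) *\<^sub>R (c *\<^sub>R x)) \<le> (1/c) * q (c *\<^sub>R x)"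
      using c by (intro scale) simp
    then have "c * q x \<le> q (c *\<^sub>R x)"
      using c by (simp add: field_simps)
    with scale[OF c, of x] show ?thesis by simp
  qed
qed

text \<open>The functional \<open>q y = inf\<^bsub>t \<ge> 0\<^esub> (p (y + t z) - t p z)\<close> is \<open>p\<close> pushed down as far as possible in
the direction \<open>z\<close>.  The parameter \<open>t = 0\<close> gives \<open>q \<le> p\<close> and \<open>t = 1\<close> gives the last bound.  This one
construction serves twice: it shows that a minimal sublinear functional is additive, and it makes
a functional below the norm attain the norm at a prescribed vector.\<close>

lemma sublinear_shift:
  fixes p :: "'a::real_vector \<Rightarrow> real"
  assumes p: "sublinear p"
  obtains q where "sublinear q" "\<And>y. q y \<le> p y" "\<And>y. q y \<le> p (y + z) - p z"
proof -
  have add: "p (x + y) \<le> p x + p y" for x y using p by (simp add: sublinear_def)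
  have sc: "0 \<le> c \<Longrightarrow> p (c *\<^sub>R x) = c * p x" for c x using p by (simp add: sublinear_def)
  define h where "h y t = p (y + t *\<^sub>R z) - t * p z" for y t
  define q where "q y = (INF t\<in>{0..}. h y t)" for y
  have lower: "- p (- y) \<le> h y t" if "t \<ge> 0" for y t
    using add[of "y + t *\<^sub>R z" "- y"] sc[OF that, of z] by (simp add: h_def)
  have le: "q y \<le> h y t" if "t \<ge> 0" for y t
    unfolding q_def by (rule cINF_lower) (use that lower in \<open>auto intro!: bdd_belowI\<close>)
  have ge: "b \<le> q y" if "\<And>t. t \<ge> 0 \<Longrightarrow> b \<le> h y t" for b y
    unfolding q_def by (rule cINF_greatest) (use that in auto)
  have "sublinear q"
  proof (rule sublinear_from_half_homogeneity)
    fix x y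
    have *: "q (x + y) \<le> h x s + h y t" if "s \<ge> 0" "t \<ge> 0" for s t
    proof -
      have "q (x + y) \<le> h (x + y) (s + t)" using that by (intro le) simp
      also have "\<dots> \<le> h x s + h y t"
        using add[of "x + s *\<^sub>R z" "y + t *\<^sub>R z"] by (simp add: h_def algebra_simps)
      finally show ?thesis .
    qed
    have "q (x + y) - h y t \<le> q x" if "t \<ge> 0" for t
      using *[OF _ that] by (intro ge) (simp add: algebra_simps)
    then have "q (x + y) - q x \<le> q y"
      by (intro ge) (simp add: algebra_simps)
    then show "q (x + y) \<le> q x + q y" by simp
  next
    have "h 0 t = 0" if "t \<ge> 0" for t using sc[OF that, of z] by (simp add: h_def)
    then show "q 0 = 0" using le[of 0 0] ge[of 0 0] by force
  next
    fix c :: real and x assume c: "c > 0"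
    have "q (c *\<^sub>R x) / c \<le> q x"
    proof (rule ge)
      fix t :: real assume t: "t \<ge> 0"
      have "q (c *\<^sub>R x) \<le> h (c *\<^sub>R x) (c * t)" using c t by (intro le) simp
      also have "\<dots> = c * h x t"
        using sc[of c "x + t *\<^sub>R z"] c by (simp add: h_def algebra_simps)
      finally show "q (c *\<^sub>R x) / c \<le> h x t" using c by (simp add: field_simps)
    qed
    then show "q (c *\<^sub>R x) \<le> c * q x" using c by (simp add: field_simps)
  qed
  then show thesis
    by (rule that) (use le[of 0] le[of 1] in \<open>simp_all add: h_def\<close>)
qed

text \<open>The pointwise infimum works.  It is finite because \<open>q y \<ge> - q (- y) \<ge> - p (- y)\<close> throughout the chain,
and it is subadditive because two members of the chain have a common lower bound in it.\<close>

lemma sublinear_chain_Inf: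
  assumes ne: "C \<noteq> {}" and sub: "\<And>q. q \<in> C \<Longrightarrow> sublinear q"
    and le: "\<And>q y. q \<in> C \<Longrightarrow> q y \<le> p y"
    and chain: "\<And>q r. q \<in> C \<Longrightarrow> r \<in> C \<Longrightarrow> q \<le> r \<or> r \<le> q"
  obtains u where "sublinear u" "\<And>q. q \<in> C \<Longrightarrow> u \<le> q"
proof -
  define u where "u y = (INF q\<in>C. q y)" for y
  have lower: "- p (- y) \<le> q y" if "q \<in> C" for q y
    using sublinear_lower_bound[OF sub[OF that], of y] le[OF that, of "- y"] by simp
  have u_le: "u y \<le> q y" if "q \<in> C" for q y
    unfolding u_def by (rule cINF_lower) (use that lower in \<open>auto intro!: bdd_belowI\<close>)
  have u_ge: "b \<le> u y" if "\<And>q. q \<in> C \<Longrightarrow> b \<le> q y" for b y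
    unfolding u_def by (rule cINF_greatest) (use that ne in auto)
  have "sublinear u"
  proof (rule sublinear_from_half_homogeneity)
    fix x y
    have *: "u (x + y) \<le> q x + r y" if qr: "q \<in> C" "r \<in> C" for q r
    proof -
      obtain m where m: "m \<in> C" "m \<le> q" "m \<le> r" using chain[OF qr] qr by blast
      have "u (x + y) \<le> m (x + y)" using m by (intro u_le)
      also have "\<dots> \<le> m x + m y" using sub[OF m(1)] by (simp add: sublinear_def)
      also have "\<dots> \<le> q x + r y" using m by (simp add: le_fun_def add_mono)
      finally show ?thesis .
    qed
    have "u (x + y) - r y \<le> u x" if "r \<in> C" for r
      using *[OF _ that] by (intro u_ge) (simp add: algebra_simps)
    then have "u (x + y) - u x \<le> u y"
      by (intro u_ge) (simp add: algebra_simps)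
    then show "u (x + y) \<le> u x + u y" by simp
  next
    have "q 0 = 0" if "q \<in> C" for q using sublinear_zero[OF sub[OF that]] .
    then have "(\<lambda>q. q 0) ` C = {0}" using ne by force
    then show "u 0 = 0" by (simp add: u_def)
  next
    fix c :: real and x assume c: "c > 0"
    have "u (c *\<^sub>R x) / c \<le> u x"
    proof (rule u_ge)
      fix q assume q: "q \<in> C"
      have "u (c *\<^sub>R x) \<le> c * q x"
        using u_le[OF q, of "c *\<^sub>R x"] sub[OF q] c by (simp add: sublinear_def)
      then show "u (c *\<^sub>R x) / c \<le> q x" using c by (simp add: field_simps)
    qed
    then show "u (c *\<^sub>R x) \<le> c * u x" using c by (simp add: field_simps)
  qed
  then show thesis using u_le by (intro that) (auto simp: le_fun_def)
qed

text \<open>By Zorn's lemma there is a minimal sublinear functional \<open>m\<close> below \<open>p\<close>.  Pushing \<open>m\<close> down in the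
direction \<open>z\<close> cannot change it, so \<open>m y \<le> m (y + z) - m z\<close>, and \<open>m\<close> is additive.\<close>

lemma sublinear_dominates_linear:
  fixes p :: "'a::real_vector \<Rightarrow> real"
  assumes p: "sublinear p"
  obtains f where "linear f" "\<And>y. f y \<le> p y"
proof -
  define A where "A = {q. sublinear q \<and> q \<le> p}"
  have "\<exists>m\<in>A. \<forall>a\<in>A. a \<le> m \<longrightarrow> a = m"
  proof (rule predicate_Zorn)
    show "partial_order_on A (relation_of (\<lambda>q r. r \<le> q) A)"
      by (rule partial_order_on_relation_ofI) auto
    fix C assume "C \<in> Chains (relation_of (\<lambda>q r. r \<le> q) A)"
    then have C: "q \<in> C \<Longrightarrow> q \<in> A" and ch: "q \<in> C \<Longrightarrow> r \<in> C \<Longrightarrow> q \<le> r \<or> r \<le> q" for q r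
      unfolding Chains_def relation_of_def by blast+
    show "\<exists>u\<in>A. \<forall>a\<in>C. u \<le> a"
    proof (cases "C = {}")
      case True then show ?thesis using p by (auto simp: A_def)
    next
      case False
      obtain u where u: "sublinear u" "\<And>q. q \<in> C \<Longrightarrow> u \<le> q"
        by (rule sublinear_chain_Inf[OF False, of p])
          (use C ch in \<open>auto simp: A_def le_fun_def\<close>)
      obtain q where "q \<in> C" using False by blast
      then have "u \<le> p" using u(2)[of q] C[of q] by (auto simp: A_def)
      then show ?thesis using u by (auto simp: A_def)
    qed
  qed
  then obtain m where m: "sublinear m" "m \<le> p"
    and min: "\<And>q. sublinear q \<Longrightarrow> q \<le> m \<Longrightarrow> q = m"
    unfolding A_def using order_trans by blast
  have super: "m y + m z \<le> m (y + z)" for y z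
  proof -
    obtain q where q: "sublinear q" "\<And>y. q y \<le> m y" "\<And>y. q y \<le> m (y + z) - m z"
      using sublinear_shift[OF m(1), of z] by blast
    have "q = m" using q by (intro min) (auto simp: le_fun_def)
    then show ?thesis using q(3)[of y] by simp
  qed
  have add: "m (y + z) = m y + m z" for y z
    using super[of y z] m(1) by (force simp: sublinear_def intro!: antisym)
  have neg: "m (- y) = - m y" for y
    using add[of y "- y"] sublinear_zero[OF m(1)] by simp
  have "linear m"
  proof (rule linearI[OF add])
    fix c x
    show "m (c *\<^sub>R x) = c *\<^sub>R m x"
    proof (cases "c \<ge> 0")
      case True then show ?thesis using m(1) by (simp add: sublinear_def)
    next
      case False
      then have "m ((- c) *\<^sub>R x) = (- c) * m x"
        using m(1) unfolding sublinear_def by (meson linear neg_0_le_iff_le)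
      then show ?thesis using neg[of "c *\<^sub>R x"] by simp
    qed
  qed
  then show thesis using m(2) by (intro that) (auto simp: le_fun_def)
qed

text \<open>Before passing to a linear minorant, the norm is pushed down in the direction \<open>x\<close>.  The result takes a
value at most \<open>- norm x\<close> at \<open>- x\<close>, which forces \<open>f x \<ge> norm x\<close>.\<close>

lemma norming_functional_exists:
  fixes x :: "'a::real_normed_vector"
  obtains f :: "'a \<Rightarrow> real" where "linear f" "\<And>y. f y \<le> norm y" "f x = norm x"
proof -
  have "sublinear (norm :: 'a \<Rightarrow> real)"
    by (auto simp: sublinear_def norm_triangle_ineq)
  then obtain q :: "'a \<Rightarrow> real" where q: "sublinear q" "\<And>y. q y \<le> norm y"
      "\<And>y. q y \<le> norm (y + x) - norm x"
    using sublinear_shift[where z = x] by blast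
  obtain f where f: "linear f" "\<And>y. f y \<le> q y"
    using sublinear_dominates_linear[OF q(1)] by blast
  have "- f x \<le> - norm x"
    using f(2)[of "- x"] q(3)[of "- x"] linear_neg[OF f(1), of x] by simp
  moreover have fle: "f y \<le> norm y" for y using f(2) q(2) order_trans by blast
  ultimately have "f x = norm x" using fle[of x] by simp
  then show thesis using f(1) fle that by blast
qed

section \<open>Finite families of linear functionals\<close>

lemma (in vector_space) linear_functionalI:
  assumes "\<And>x y. f (x + y) = f x + f y" "\<And>c x. f (scale c x) = c * f x"
  shows "Vector_Spaces.linear scale (*) f"
proof -
  have "vector_space ((*) :: 'a \<Rightarrow> 'a \<Rightarrow> 'a)"
    by unfold_locales (auto simp: algebra_simps)
  then show ?thesis
    unfolding Vector_Spaces.linear_iff using assms vector_space_axioms by blast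
qed

lemma (in vector_space) linear_functionalD:
  assumes "Vector_Spaces.linear scale (*) f"
  shows "f (x + y) = f x + f y" "f (scale c x) = c * f x"
  using assms unfolding Vector_Spaces.linear_iff by blast+

text \<open>The common kernel of finitely many functionals has a finite-dimensional complement.  A new functional
\<open>g\<close> that does not vanish on the old common kernel costs one more dimension, spanned by a vector \<open>e\<close> of
that kernel with \<open>g e \<noteq> 0\<close>.\<close>

lemma (in vector_space) finite_functionals_finite_codimension:
  assumes "finite F" "\<And>f. f \<in> F \<Longrightarrow> Vector_Spaces.linear scale (*) f"
  shows "\<exists>B. finite B \<and> (\<forall>x. \<exists>b\<in>span B. \<forall>f\<in>F. f (x - b) = 0)"
  using assms
proof (induction F rule: finite_induct)
  case empty
  show ?case by (rule exI[of _ "{}"]) auto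
next
  case (insert g F)
  obtain B where B: "finite B" "\<And>x. \<exists>b\<in>span B. \<forall>f\<in>F. f (x - b) = 0"
    using insert by blast
  show ?case
  proof (cases "\<exists>e. (\<forall>f\<in>F. f e = 0) \<and> g e \<noteq> 0")
    case False
    then have "\<forall>f\<in>insert g F. f (x - b) = 0" if "\<forall>f\<in>F. f (x - b) = 0" for x b
      using that by blast
    then show ?thesis using B by meson
  next
    case True
    then obtain e where e: "\<And>f. f \<in> F \<Longrightarrow> f e = 0" "g e \<noteq> 0" by blast
    have lin: "f (u - scale c v) = f u - c * f v" if "f \<in> insert g F" for f u v c
      using module_hom.diff[of scale "(*)" f u "scale c v"] module_hom.scale[of scale "(*)" f c v]
        insert.prems[OF that] by (simp add: linear_iff_module_hom)
    have "\<exists>b\<in>span (insert e B). \<forall>f\<in>insert g F. f (x - b) = 0" for x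
    proof -
      obtain b where b: "b \<in> span B" "\<And>f. f \<in> F \<Longrightarrow> f (x - b) = 0" using B(2)[of x] by blast
      define b' where "b' = b + scale (g (x - b) / g e) e"
      have eq: "x - b' = (x - b) - scale (g (x - b) / g e) e" by (simp add: b'_def)
      have "b' \<in> span (insert e B)"
        unfolding b'_def using b(1) span_mono[of B "insert e B"]
        by (intro span_add[OF _ span_scale[OF span_base]]) auto
      moreover have "f (x - b') = 0" if "f \<in> insert g F" for f
        unfolding eq lin[OF that] using that b(2)[of f] e(1)[of f] e(2) by auto
      ultimately show ?thesis by blast
    qed
    then show ?thesis using B(1) by (intro exI[of _ "insert e B"]) auto
  qed
qed

section \<open>Interpolation by linear combinations of functionals\<close>

text \<open>Formal linear combinations are lists of coefficient-functional pairs.  This allows one to replace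
coefficients one at a time and to bound the number of combinations by counting lists.\<close>

definition combination :: "('k::comm_semiring_0 \<times> ('a \<Rightarrow> 'k)) list \<Rightarrow> 'a \<Rightarrow> 'k" where
  "combination ps x = (\<Sum>(c, f)\<leftarrow>ps. c * f x)"

lemma combination_Nil [simp]: "combination [] x = 0"
  and combination_Cons [simp]: "combination ((c, f) # ps) x = c * f x + combination ps x"
  and combination_append [simp]: "combination (ps @ qs) x = combination ps x + combination qs x"
  by (auto simp: combination_def)

lemma (in vector_space) linear_combination_of_functionals:
  assumes "ps \<in> lists (UNIV \<times> F)" "\<And>f. f \<in> F \<Longrightarrow> Vector_Spaces.linear scale (*) f"
  shows "Vector_Spaces.linear scale (*) (combination ps)"
  using assms(1)
proof (induction ps)
  case Nil
  show ?case by (rule linear_functionalI) auto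
next
  case (Cons p ps)
  obtain c f where p: "p = (c, f)" by (cases p)
  have f: "Vector_Spaces.linear scale (*) f" using Cons.hyps assms(2) by (simp add: p)
  show ?case
    by (rule linear_functionalI)
      (simp_all add: p linear_functionalD[OF f] linear_functionalD[OF Cons.IH] algebra_simps)
qed

lemma scaled_combination:
  assumes "ps \<in> lists (UNIV \<times> F)"
  obtains qs where "qs \<in> lists (UNIV \<times> F)" "\<And>x. combination qs x = c * combination ps x"
proof
  show "map (\<lambda>(d, f). (c * d, f)) ps \<in> lists (UNIV \<times> F)" using assms by auto
  show "combination (map (\<lambda>(d, f). (c * d, f)) ps) x = c * combination ps x" for x
    by (induction ps) (auto simp: algebra_simps)
qed

lemma sum_of_combinations:
  assumes "finite S" "\<And>s. s \<in> S \<Longrightarrow> e s \<in> lists (UNIV \<times> F)"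
  obtains qs where "qs \<in> lists (UNIV \<times> F)"
    "\<And>x. combination qs x = (\<Sum>s\<in>S. c s * combination (e s) x)"
  using assms
proof (induction S arbitrary: thesis rule: finite_induct)
  case empty
  show ?case by (rule empty(1)[of "[]"]) auto
next
  case (insert a S)
  obtain qs where qs: "qs \<in> lists (UNIV \<times> F)"
    "\<And>x. combination qs x = (\<Sum>s\<in>S. c s * combination (e s) x)"
    using insert.IH insert.prems(2) by blast
  obtain rs where rs: "rs \<in> lists (UNIV \<times> F)" "\<And>x. combination rs x = c a * combination (e a) x"
    using scaled_combination[of "e a" F "c a"] insert.prems(2) by blast
  show ?case
    by (rule insert.prems(1)[of "rs @ qs"]) (use qs rs insert.hyps in auto)
qed

text \<open>Induction on \<open>B\<close>.  The induction hypothesis supplies a dual basis \<open>e\<close> for \<open>B\<close>.  Subtracting from a new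
vector \<open>x\<close> its projection along \<open>e\<close> leaves \<open>y \<noteq> 0\<close>, and some \<open>f \<in> F\<close> does not vanish at \<open>y\<close>.  The same
projection, transposed and subtracted from \<open>f\<close>, gives a combination that vanishes on \<open>B\<close> and takes the
value \<open>f y\<close> at \<open>x\<close>; a multiple of it corrects the value at \<open>x\<close> without disturbing those on \<open>B\<close>.\<close>

lemma (in vector_space) separating_combination_interpolates:
  assumes lin: "\<And>f. f \<in> F \<Longrightarrow> Vector_Spaces.linear scale (*) f"
    and sep: "\<And>y. y \<noteq> 0 \<Longrightarrow> \<exists>f\<in>F. f y \<noteq> 0"
    and B: "finite B" "independent B"
  shows "\<exists>ps\<in>lists (UNIV \<times> F). \<forall>b\<in>B. combination ps b = g b"
  using B
proof (induction B arbitrary: g rule: finite_induct)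
  case empty
  show ?case by (rule bexI[of _ "[]"]) auto
next
  case (insert x B)
  have B: "independent B" "x \<notin> span B"
    using insert.prems insert.hyps by (auto simp: independent_insert)
  have "\<forall>s. \<exists>ps\<in>lists (UNIV \<times> F). \<forall>b\<in>B. combination ps b = (if b = s then 1 else 0)"
    by (intro allI insert.IH[OF B(1)])
  then obtain e where e: "\<And>s. e s \<in> lists (UNIV \<times> F)"
    "\<And>s b. b \<in> B \<Longrightarrow> combination (e s) b = (if b = s then 1 else 0)" by metis
  define y where "y = x - (\<Sum>b\<in>B. scale (combination (e b) x) b)"
  have "(\<Sum>b\<in>B. scale (combination (e b) x) b) \<in> span B"
    by (intro span_sum span_scale span_base)
  then have "y \<noteq> 0" using B(2) unfolding y_def by auto
  then obtain f where f: "f \<in> F" "f y \<noteq> 0" using sep by blast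
  have fy: "f y = f x - (\<Sum>b\<in>B. combination (e b) x * f b)"
    using lin[OF f(1)] unfolding y_def linear_iff_module_hom
    by (simp add: module_hom.diff module_hom.sum module_hom.scale)
  obtain cs where cs: "cs \<in> lists (UNIV \<times> F)"
    "\<And>z. combination cs z = (\<Sum>b\<in>B. - f b * combination (e b) z)"
    using sum_of_combinations[OF insert.hyps(1), of e F "\<lambda>b. - f b"] e(1) by blast
  define us where "us = (1, f) # cs"
  have us: "us \<in> lists (UNIV \<times> F)" using cs(1) f(1) by (simp add: us_def)
  have usx: "combination us x = f y"
    unfolding us_def fy by (simp add: cs(2) sum_negf mult.commute)
  have usB: "combination us b = 0" if "b \<in> B" for b
  proof -
    have "combination us b = f b + (\<Sum>s\<in>B. if b = s then - f s else 0)"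
      unfolding us_def by (simp add: cs(2) e(2)[OF that] if_distrib cong: if_cong sum.cong)
    also have "\<dots> = 0"
      using that insert.hyps(1) by simp
    finally show ?thesis .
  qed
  obtain ps where ps: "ps \<in> lists (UNIV \<times> F)" "\<And>b. b \<in> B \<Longrightarrow> combination ps b = g b"
    using insert.IH[OF B(1), of g] by blast
  obtain vs where vs: "vs \<in> lists (UNIV \<times> F)"
    "\<And>z. combination vs z = ((g x - combination ps x) / f y) * combination us z"
    using scaled_combination[OF us] by blast
  show ?case
    by (rule bexI[of _ "ps @ vs"]) (use ps vs usx usB f(2) in auto)
qed

section \<open>Weak-star density of combinations with coefficients in a dense set\<close>

text \<open>Each coefficient is moved into \<open>Q\<close> in turn; the functionals involved are bounded on the finite set \<open>S\<close>.\<close>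

lemma combination_approximation:
  fixes Q :: "'k::real_normed_field set"
  assumes dense: "\<And>c \<epsilon>. \<epsilon> > 0 \<Longrightarrow> \<exists>q\<in>Q. norm (q - c) < \<epsilon>"
    and "finite S" "ps \<in> lists (UNIV \<times> F)" "\<epsilon> > 0"
  shows "\<exists>qs\<in>lists (Q \<times> F). \<forall>s\<in>S. norm (combination qs s - combination ps s) < \<epsilon>"
  using assms(3,4)
proof (induction ps arbitrary: \<epsilon>)
  case Nil
  then show ?case by (intro bexI[of _ "[]"]) auto
next
  case (Cons p ps)
  obtain c f where p: "p = (c, f)" by (cases p)
  have f: "f \<in> F" using Cons.hyps by (simp add: p)
  obtain qs where qs: "qs \<in> lists (Q \<times> F)"
    "\<And>s. s \<in> S \<Longrightarrow> norm (combination qs s - combination ps s) < \<epsilon>/2"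
    using Cons.IH[of "\<epsilon>/2"] Cons.prems by auto
  \<comment> \<open>The summand 1 keeps the bound positive, also when every value of f on S is 0.\<close>
  define M where "M = 1 + (\<Sum>s\<in>S. norm (f s))"
  have M: "M > 0" unfolding M_def by (smt (verit) sum_nonneg norm_ge_zero)
  obtain q where q: "q \<in> Q" "norm (q - c) < \<epsilon> / (2 * M)"
    using dense[of "\<epsilon> / (2 * M)" c] Cons.prems M by auto
  have "norm (combination ((q, f) # qs) s - combination (p # ps) s) < \<epsilon>" if s: "s \<in> S" for s
  proof -
    have "norm (f s) \<le> M"
      unfolding M_def using member_le_sum[OF s, of "\<lambda>s. norm (f s)"] \<open>finite S\<close> by simp
    then have "norm (q - c) * norm (f s) \<le> \<epsilon> / (2 * M) * M"
      using q(2) M Cons.prems by (intro mult_mono) auto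
    then have 1: "norm ((q - c) * f s) \<le> \<epsilon>/2" using M by (simp add: norm_mult)
    have "combination ((q, f) # qs) s - combination (p # ps) s =
        (q - c) * f s + (combination qs s - combination ps s)"
      by (simp add: p algebra_simps)
    also have "norm \<dots> < \<epsilon>"
      using norm_triangle_ineq[of "(q - c) * f s" "combination qs s - combination ps s"]
        1 qs(2)[OF s] by linarith
    finally show ?thesis .
  qed
  then show ?case using q(1) qs(1) f by (intro bexI[of _ "(q, f) # qs"]) auto
qed

text \<open>There are countably many lengths, and lists of each fixed length inject into a finite power of \<open>A\<close>.\<close>

lemma card_of_lists_ordLeq:
  assumes inf: "infinite A"
  shows "|lists A| \<le>o |A|"
proof -
  have len: "|{xs \<in> lists A. length xs = n}| \<le>o |A|" for n
  proof (induction n)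
    case 0
    have "{xs \<in> lists A. length xs = 0} = {[]}" by auto
    then show ?case using inf card_of_singl_ordLeq[of A "[]"] by auto
  next
    case (Suc n)
    have "{xs \<in> lists A. length xs = Suc n} \<subseteq> (\<lambda>(x, xs). x # xs) ` (A \<times> {xs \<in> lists A. length xs = n})"
      by (auto simp: length_Suc_conv)
    then have "|{xs \<in> lists A. length xs = Suc n}| \<le>o |A \<times> {xs \<in> lists A. length xs = n}|"
      by (rule ordLeq_transitive[OF card_of_mono1 card_of_image])
    also have "|A \<times> {xs \<in> lists A. length xs = n}| \<le>o |A|"
      by (rule card_of_Times_ordLeq_infinite_Field[OF _ card_of_mono1 Suc card_of_Card_order])
        (simp_all add: inf Field_card_of)
    finally show ?case .
  qed
  have "lists A = (\<Union>n\<in>(UNIV::nat set). {xs \<in> lists A. length xs = n})" by auto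
  moreover have "|\<Union>n\<in>(UNIV::nat set). {xs \<in> lists A. length xs = n}| \<le>o |A|"
    by (rule card_of_UNION_ordLeq_infinite[OF inf])
      (use inf len in \<open>simp_all add: infinite_iff_card_of_nat[THEN iffD1]\<close>)
  ultimately show ?thesis by simp
qed

text \<open>A basic \<open>w\<^sup>*\<close>-neighbourhood of \<open>g\<close> constrains values on a finite set \<open>S\<close> only.  A combination of \<open>F\<close>
that equals \<open>g\<close> on a maximal independent subset of \<open>S\<close> equals it on \<open>S\<close>, and perturbing its
coefficients into \<open>Q\<close> keeps it in the neighbourhood.\<close>

lemma (in banach_space_over) weak_star_dense_combinations:
  fixes Q :: "'k set"
  assumes dense: "\<And>c \<epsilon>. \<epsilon> > 0 \<Longrightarrow> \<exists>q\<in>Q. norm (q - c) < \<epsilon>"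
    and F: "F \<subseteq> continuous_dual sc"
    and sep: "\<And>y. y \<noteq> 0 \<Longrightarrow> \<exists>f\<in>F. f y \<noteq> 0"
  shows "dense_subset_of (weak_star_topology sc) (combination ` lists (Q \<times> F))"
proof -
  have lin: "f \<in> F \<Longrightarrow> Vector_Spaces.linear sc (*) f" for f
    using F by (auto simp: continuous_dual_def)
  have top: "topspace (weak_star_topology sc) = continuous_dual sc"
    by (simp add: weak_star_topology_def)
  have "combination ps \<in> continuous_dual sc" if ps: "ps \<in> lists (Q \<times> F)" for ps
  proof -
    have "Vector_Spaces.linear sc (*) (combination ps)"
      using ps by (intro linear_combination_of_functionals[of _ F] lin) auto
    moreover have "continuous_on UNIV (combination ps)"
      using ps
    proof (induction ps)
      case Nil
      show ?case by (simp add: combination_def)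
    next
      case (Cons p ps)
      obtain c f where p: "p = (c, f)" by (cases p)
      have "continuous_on UNIV f" using Cons.hyps F by (auto simp: p continuous_dual_def)
      moreover have "combination (p # ps) = (\<lambda>x. c * f x + combination ps x)"
        by (auto simp: p)
      ultimately show ?case using Cons.IH by (simp add: continuous_intros)
    qed
    ultimately show ?thesis by (simp add: continuous_dual_def)
  qed
  then have sub: "combination ` lists (Q \<times> F) \<subseteq> continuous_dual sc" by blast
  have "g \<in> weak_star_topology sc closure_of (combination ` lists (Q \<times> F))"
    if g: "g \<in> continuous_dual sc" for g
    unfolding in_closure_of top
  proof (intro conjI g allI impI)
    fix T assume "g \<in> T \<and> openin (weak_star_topology sc) T"
    then obtain W where W: "openin (product_topology (\<lambda>_. euclidean) UNIV) W"
      "T = W \<inter> continuous_dual sc" "g \<in> W"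
      unfolding weak_star_topology_def openin_subtopology by auto
    then obtain U where U: "finite {i. U i \<noteq> (UNIV::'k set)}" "\<And>i. open (U i)"
      "\<And>i. g i \<in> U i" "Pi\<^sub>E UNIV U \<subseteq> W"
      unfolding openin_product_topology_alt by (fastforce simp: PiE_iff)
    define S where "S = {i. U i \<noteq> (UNIV::'k set)}"
    have S: "finite S" using U(1) by (simp add: S_def)
    have "\<forall>i. \<exists>d>0. ball (g i) d \<subseteq> U i"
      using U(2,3) open_contains_ball by blast
    then obtain d where d: "\<And>i. d i > 0" "\<And>i. ball (g i) (d i) \<subseteq> U i" by metis
    \<comment> \<open>Inserting 1 gives the minimum a meaning for empty S.\<close>
    define \<epsilon> where "\<epsilon> = Min (insert 1 (d ` S))"
    have \<epsilon>: "\<epsilon> > 0" "\<And>i. i \<in> S \<Longrightarrow> \<epsilon> \<le> d i"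
      using S d(1) by (auto simp: \<epsilon>_def)
    obtain B where B: "B \<subseteq> S" "independent B" "S \<subseteq> span B"
      using maximal_independent_subset by blast
    obtain ps where ps: "ps \<in> lists (UNIV \<times> F)" "\<And>b. b \<in> B \<Longrightarrow> combination ps b = g b"
      using separating_combination_interpolates[OF lin sep, of B g] B finite_subset[OF B(1) S]
      by blast
    have lin_ps: "Vector_Spaces.linear sc (*) (combination ps)"
      by (rule linear_combination_of_functionals[OF ps(1) lin])
    have lin_g: "Vector_Spaces.linear sc (*) g" using g by (simp add: continuous_dual_def)
    have "span B \<subseteq> {x. combination ps x = g x}"
    proof (rule span_minimal)
      show "subspace {x. combination ps x = g x}"
        using linear_functionalD(2)[OF lin_ps, of 0 0] linear_functionalD(2)[OF lin_g, of 0 0]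
        by (simp add: subspace_def linear_functionalD[OF lin_ps] linear_functionalD[OF lin_g])
    qed (use ps(2) in blast)
    then have ps_S: "combination ps s = g s" if "s \<in> S" for s
      using that B(3) by blast
    obtain qs where qs: "qs \<in> lists (Q \<times> F)"
      "\<And>s. s \<in> S \<Longrightarrow> norm (combination qs s - combination ps s) < \<epsilon>"
      using combination_approximation[OF dense S ps(1) \<epsilon>(1)] by blast
    have "combination qs i \<in> U i" for i
    proof (cases "i \<in> S")
      case True
      have "dist (g i) (combination qs i) < d i"
        using qs(2)[OF True] \<epsilon>(2)[OF True] ps_S[OF True]
        by (simp add: dist_norm norm_minus_commute)
      then show ?thesis using d(2)[of i] by auto
    qed (simp add: S_def)
    then have "combination qs \<in> W" using U(4) by (auto simp: PiE_iff)
    then show "\<exists>y. y \<in> combination ` lists (Q \<times> F) \<and> y \<in> T"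
      using qs(1) sub W(2) by blast
  qed
  then show ?thesis
    unfolding dense_subset_of_def top
    using sub closure_of_subset_topspace[of "weak_star_topology sc"] top by blast
qed

text \<open>A finite family with trivial common kernel would contradict infinite dimension, and an infinite one
would produce a \<open>w\<^sup>*\<close>-dense set of the same cardinality as the family.\<close>

lemma few_functionals_common_zero:
  fixes sc :: "'k::{real_normed_field, second_countable_topology} \<Rightarrow> 'a::banach \<Rightarrow> 'a"
  assumes X: "banach_space_over sc" and inf: "infinite_dimensional sc"
    and F: "F \<subseteq> continuous_dual sc"
    and card: "|F| <o density_character (weak_star_topology sc)"
  shows "\<exists>y. y \<noteq> 0 \<and> (\<forall>f\<in>F. f y = 0)"
proof (rule ccontr)
  assume "\<not> ?thesis"
  then have sep: "\<And>y. y \<noteq> 0 \<Longrightarrow> \<exists>f\<in>F. f y \<noteq> 0" by blast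
  interpret banach_space_over sc by (rule X)
  show False
  proof (cases "finite F")
    case True
    have "Vector_Spaces.linear sc (*) f" if "f \<in> F" for f
      using F that by (auto simp: continuous_dual_def)
    then obtain B where B: "finite B" "\<And>x. \<exists>b\<in>span B. \<forall>f\<in>F. f (x - b) = 0"
      using finite_functionals_finite_codimension[OF True] by blast
    have "x \<in> span B" for x
    proof -
      obtain b where b: "b \<in> span B" "\<forall>f\<in>F. f (x - b) = 0" using B(2) by blast
      then have "x - b = 0" using sep by blast
      then show ?thesis using b(1) by simp
    qed
    then have "span B = UNIV" by blast
    then show False using inf B(1) unfolding infinite_dimensional_def by blast
  next
    case False
    obtain Q :: "'k set" where Q: "countable Q" "\<And>U. open U \<Longrightarrow> U \<noteq> {} \<Longrightarrow> \<exists>q\<in>Q. q \<in> U"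
      using countable_dense_exists by blast
    have Qd: "\<exists>q\<in>Q. norm (q - c) < \<epsilon>" if "\<epsilon> > 0" for c :: 'k and \<epsilon>
      using Q(2)[of "ball c \<epsilon>"] that by (auto simp: dist_norm norm_minus_commute)
    have "Q \<noteq> {}" using Q(2)[of UNIV] by auto
    with False have inf': "infinite (Q \<times> F)" by (auto simp: finite_cartesian_product_iff)
    have "|Q| \<le>o |F|"
    proof (rule ordLeq_transitive)
      show "|Q| \<le>o |UNIV :: nat set|"
        using Q(1) unfolding countable_def by (subst card_of_ordLeq[symmetric]) blast
      show "|UNIV :: nat set| \<le>o |F|"
        using False by (simp only: infinite_iff_card_of_nat)
    qed
    from card_of_Times_ordLeq_infinite_Field[OF _ this card_of_mono1 card_of_Card_order]
    have QF: "|Q \<times> F| \<le>o |F|" using False by (simp add: Field_card_of)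
    obtain D where D: "density_character (weak_star_topology sc) = |D|"
      "\<And>D'. dense_subset_of (weak_star_topology sc) D' \<Longrightarrow> |D| \<le>o |D'|"
      using density_character_witness by blast
    have "|D| \<le>o |combination ` lists (Q \<times> F)|"
      by (intro D(2) weak_star_dense_combinations Qd F sep)
    also have "|combination ` lists (Q \<times> F)| \<le>o |lists (Q \<times> F)|" by (rule card_of_image)
    also have "|lists (Q \<times> F)| \<le>o |Q \<times> F|" by (rule card_of_lists_ordLeq[OF inf'])
    also note QF
    finally show False using not_ordLess_ordLeq[OF card] D(1) by simp
  qed
qed

section \<open>Separation by transfinite recursion\<close>

text \<open>If \<open>norm (x + y) = 1\<close>, then \<open>f\<close> equals \<open>1\<close> at the distinct unit vectors \<open>x\<close> and \<open>x + y\<close>, and so at their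
midpoint, which lies strictly inside the unit ball.\<close>

lemma norm_gt_one_of_norming_functional:
  fixes x y :: "'a::real_normed_vector"
  assumes sc: "strictly_convex_space TYPE('a)"
    and f: "linear f" "\<And>z. f z \<le> norm z" "f x = (1::real)" "f y = 0"
    and x: "norm x = 1" and y: "y \<noteq> 0"
  shows "norm (x + y) > 1"
proof (rule ccontr)
  assume "\<not> norm (x + y) > 1"
  moreover have "f (x + y) = 1" using f by (simp add: linear_add)
  ultimately have 1: "norm (x + y) = 1" using f(2)[of "x + y"] by simp
  have "f ((1/2) *\<^sub>R (x + (x + y))) = 1"
    using f by (simp add: linear_add linear_scale)
  then have "norm ((1/2) *\<^sub>R (x + (x + y))) \<ge> 1" using f(2) by metis
  moreover have "x \<noteq> x + y" using y by simp
  ultimately show False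
    using sc x 1 unfolding strictly_convex_space_def by force
qed

text \<open>The hypothesis \<open>norming\<close> is where real and complex scalars differ: a real norming functional
\<open>f\<close> need not belong to the dual over \<open>'k\<close>, but some \<open>g\<close> that does has its kernel inside that of \<open>f\<close>.\<close>

lemma separated_set_of_dual_norming:
  fixes sc :: "'k::{real_normed_field, second_countable_topology} \<Rightarrow> 'a::banach \<Rightarrow> 'a"
  assumes X: "banach_space_over sc" and inf: "infinite_dimensional sc"
    and convex: "strictly_convex_space TYPE('a)"
    and norming: "\<And>x::'a. norm x = 1 \<Longrightarrow> \<exists>f g. linear f \<and> (\<forall>z. f z \<le> norm z) \<and> f x = 1
        \<and> g \<in> continuous_dual sc \<and> (\<forall>z. g z = 0 \<longrightarrow> f z = (0::real))"
  shows "\<exists>A. A \<subseteq> sphere (0::'a) 1 \<and> symmetrically_one_plus_separated A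
            \<and> |A| =o density_character (weak_star_topology sc)"
proof -
  interpret banach_space_over sc by (rule X)
  define N :: "'a \<Rightarrow> ('a \<Rightarrow> real) \<Rightarrow> ('a \<Rightarrow> 'k) \<Rightarrow> bool" where
    "N x f g \<longleftrightarrow> linear f \<and> (\<forall>z. f z \<le> norm z) \<and> f x = 1
        \<and> g \<in> continuous_dual sc \<and> (\<forall>z. g z = 0 \<longrightarrow> f z = 0)" for x f g
  have "\<exists>f g. N x f g" if "norm x = 1" for x
    using norming[OF that] unfolding N_def .
  then obtain f g where fg: "\<And>x. norm x = 1 \<Longrightarrow> N x (f x) (g x)" by metis
  obtain D where D: "density_character (weak_star_topology sc) = |D|"
    using density_character_witness by blast
  \<comment> \<open>Indices range over the whole type; those outside D have no predecessors and get any unit vector.\<close>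
  have "\<exists>x. \<forall>d. norm (x d) = 1 \<and> (\<forall>e\<in>underS |D| d. g (x e) (x d) = 0)"
  proof (rule dependent_wf_choice[of "|D| - Id"])
    show "wf ( |D| - Id)"
      using card_of_Well_order[of D] by (simp add: well_order_on_def)
  next
    fix x y :: "('a \<Rightarrow> 'k) \<Rightarrow> 'a" and d r
    assume "\<And>z. (z, d) \<in> |D| - Id \<Longrightarrow> x z = y z"
    then show "(norm r = 1 \<and> (\<forall>e\<in>underS |D| d. g (x e) r = 0)) =
          (norm r = 1 \<and> (\<forall>e\<in>underS |D| d. g (y e) r = 0))"
      unfolding underS_def by simp
  next
    fix x :: "('a \<Rightarrow> 'k) \<Rightarrow> 'a" and d
    assume IH: "\<And>e. (e, d) \<in> |D| - Id \<Longrightarrow> norm (x e) = 1 \<and> (\<forall>e'\<in>underS |D| e. g (x e') (x e) = 0)"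
    let ?F = "(\<lambda>e. g (x e)) ` underS |D| d"
    have "g (x e) \<in> continuous_dual sc" if "e \<in> underS |D| d" for e
      using IH[of e] fg[of "x e"] that unfolding N_def underS_def by blast
    then have F: "?F \<subseteq> continuous_dual sc" by blast
    have "\<exists>y. y \<noteq> 0 \<and> (\<forall>h\<in>?F. h y = 0)"
    proof (cases "d \<in> D")
      case True
      then have "|underS |D| d| <o |D|"
        by (intro card_of_underS card_of_Card_order) (simp add: Field_card_of)
      then have "|?F| <o |D|" by (rule ordLeq_ordLess_trans[OF card_of_image])
      then show ?thesis by (intro few_functionals_common_zero[OF X inf F]) (simp add: D)
    next
      case False
      then have "underS |D| d = {}"
        using FieldI2[of _ d "|D|"] unfolding underS_def Field_card_of by blast
      moreover have "\<exists>y::'a. y \<noteq> 0"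
      proof (rule ccontr)
        assume "\<nexists>y::'a. y \<noteq> 0"
        then have "span {} = (UNIV :: 'a set)" unfolding span_empty by blast
        then show False using inf unfolding infinite_dimensional_def by blast
      qed
      ultimately show ?thesis by auto
    qed
    then obtain y where y: "y \<noteq> 0" "\<And>e. e \<in> underS |D| d \<Longrightarrow> g (x e) y = 0" by blast
    have "g (x e) ((1 / norm y) *\<^sub>R y) = 0" if e: "e \<in> underS |D| d" for e
    proof -
      have "Vector_Spaces.linear sc (*) (g (x e))"
        using F e by (auto simp: continuous_dual_def)
      then have "g (x e) (sc (of_real (1 / norm y)) y) = of_real (1 / norm y) * g (x e) y"
        by (rule linear_functionalD)
      then show ?thesis using y(2)[OF e] unfolding scale_of_real by simp
    qed
    moreover have "norm ((1 / norm y) *\<^sub>R y) = 1" using y(1) by simp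
    ultimately show "\<exists>r. norm r = 1 \<and> (\<forall>e\<in>underS |D| d. g (x e) r = 0)" by blast
  qed
  then obtain x where x: "\<And>d. norm (x d) = 1" "\<And>d e. e \<in> underS |D| d \<Longrightarrow> g (x e) (x d) = 0"
    by blast
  have step: "norm (x e - x d) > 1 \<and> norm (x e + x d) > 1" if "e \<in> underS |D| d" for d e
  proof -
    have N: "N (x e) (f (x e)) (g (x e))" by (rule fg[OF x(1)])
    then have 0: "f (x e) (x d) = 0" using x(2)[OF that] by (simp add: N_def)
    have lin: "linear (f (x e))" using N by (simp add: N_def)
    have ne: "x d \<noteq> 0" using x(1)[of d] by auto
    have *: "norm (x e + y) > 1" if "y \<noteq> 0" "f (x e) y = 0" for y
      using N by (intro norm_gt_one_of_norming_functional[OF convex lin _ _ that(2) x(1) that(1)])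
        (simp_all add: N_def)
    show ?thesis using *[of "x d"] *[of "- x d"] ne 0 linear_neg[OF lin] by simp
  qed
  have sep: "norm (x e - x d) > 1 \<and> norm (x e + x d) > 1"
    if "d \<in> D" "e \<in> D" "d \<noteq> e" for d e
  proof -
    have "e \<in> underS |D| d \<or> d \<in> underS |D| e"
      using card_of_Well_order[of D] that
      unfolding underS_def well_order_on_def linear_order_on_def total_on_def Field_card_of by blast
    then show ?thesis
      using step[of e d] step[of d e] by (auto simp: add.commute norm_minus_commute)
  qed
  have "inj_on x D"
  proof (rule inj_onI, rule ccontr)
    fix d e assume "d \<in> D" "e \<in> D" "x d = x e" "d \<noteq> e"
    then show False using sep[of d e] by simp
  qed
  then have "|x ` D| =o |D|"
    by (rule card_of_ordIsoI[THEN ordIso_symmetric, OF inj_on_imp_bij_betw])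
  moreover have "symmetrically_one_plus_separated (x ` D)"
    unfolding symmetrically_one_plus_separated_def using sep by blast
  moreover have "x ` D \<subseteq> sphere 0 1" using x(1) by auto
  ultimately show ?thesis unfolding D by blast
qed

section \<open>Real and complex norming functionals in the dual\<close>

lemma bounded_linear_of_norm_bound:
  fixes f :: "'a::real_normed_vector \<Rightarrow> real"
  assumes "linear f" "\<And>y. f y \<le> norm y"
  shows "bounded_linear f"
proof -
  have "\<bar>f y\<bar> \<le> norm y" for y
    using assms(2)[of y] assms(2)[of "- y"] linear_neg[OF assms(1), of y] by simp
  then show ?thesis
    using assms(1)
    by (auto simp: bounded_linear_def bounded_linear_axioms_def intro!: exI[of _ 1])
qed

text \<open>The map is \<open>z \<mapsto> f z - i f (i z)\<close>, the unique complex-linear functional with real part \<open>f\<close>.\<close>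

lemma complexified_functional_in_dual:
  fixes scaleC :: "complex \<Rightarrow> 'b::banach \<Rightarrow> 'b"
  assumes X: "banach_space_over scaleC" and f: "bounded_linear f"
  shows "(\<lambda>z. Complex (f z) (- f (scaleC \<i> z))) \<in> continuous_dual scaleC"
proof -
  interpret banach_space_over scaleC by (rule X)
  interpret f: bounded_linear f by (rule f)
  let ?g = "\<lambda>z. Complex (f z) (- f (scaleC \<i> z))"
  have split: "scaleC c z = Re c *\<^sub>R z + Im c *\<^sub>R scaleC \<i> z" for c z
  proof -
    have "scaleC c z = scaleC (of_real (Re c) + of_real (Im c) * \<i>) z"
      by (metis complex_eq mult.commute)
    then show ?thesis by (simp only: scale_left_distrib scale_of_real flip: scale_scale)
  qed
  have ii: "scaleC \<i> (scaleC \<i> z) = - z" for z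
    by (simp add: scale_scale)
  have comm: "scaleC \<i> (r *\<^sub>R z) = r *\<^sub>R scaleC \<i> z" for r z
    by (simp add: scale_left_commute flip: scale_of_real)
  have add: "?g (x + y) = ?g x + ?g y" for x y
    by (simp add: scale_right_distrib f.add complex_eq_iff)
  have mult: "?g (scaleC c z) = c * ?g z" for c z
    by (simp add: split[of c z] scale_right_distrib comm ii f.add f.diff f.scaleR f.neg complex_eq_iff)
  have "Vector_Spaces.linear scaleC (*) ?g"
    by (rule linear_functionalI[OF add mult])
  moreover have "bounded_linear (scaleC \<i>)"
    by (rule bounded_linear_intro[where K = 1])
      (simp_all add: scale_right_distrib comm norm_scale)
  then have "continuous_on UNIV ?g"
    unfolding Complex_eq
    by (intro continuous_intros f.continuous_on linear_continuous_on)
  ultimately show ?thesis by (simp add: continuous_dual_def)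
qed

theorem corollary4p7:
  fixes scaleC :: "complex \<Rightarrow> 'b::banach \<Rightarrow> 'b"
  shows
    "(infinite_dimensional (scaleR :: real \<Rightarrow> 'a::banach \<Rightarrow> 'a)
      \<and> strictly_convex_space TYPE('a)
      \<longrightarrow> (\<exists>A. A \<subseteq> sphere (0::'a) 1 \<and> symmetrically_one_plus_separated A
            \<and> |A| =o density_character (weak_star_topology (scaleR :: real \<Rightarrow> 'a \<Rightarrow> 'a))))
     \<and>
     (banach_space_over scaleC \<and> infinite_dimensional scaleC
      \<and> strictly_convex_space TYPE('b)
      \<longrightarrow> (\<exists>A. A \<subseteq> sphere (0::'b) 1 \<and> symmetrically_one_plus_separated A
            \<and> |A| =o density_character (weak_star_topology scaleC)))"
proof (intro conjI impI; elim conjE)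
  assume inf: "infinite_dimensional (scaleR :: real \<Rightarrow> 'a \<Rightarrow> 'a)"
    and convex: "strictly_convex_space TYPE('a)"
  show "\<exists>A. A \<subseteq> sphere (0::'a) 1 \<and> symmetrically_one_plus_separated A
            \<and> |A| =o density_character (weak_star_topology (scaleR :: real \<Rightarrow> 'a \<Rightarrow> 'a))"
  proof (rule separated_set_of_dual_norming[OF banach_space_over_scaleR inf convex])
    fix x :: 'a assume x: "norm x = 1"
    obtain f :: "'a \<Rightarrow> real" where f: "linear f" "\<And>y. f y \<le> norm y" "f x = norm x"
      using norming_functional_exists by blast
    have "continuous_on UNIV f"
      by (rule linear_continuous_on[OF bounded_linear_of_norm_bound[OF f(1,2)]])
    moreover have "((*\<^sub>R) :: real \<Rightarrow> real \<Rightarrow> real) = (*)" by (intro ext) simp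
    with f(1) have "Vector_Spaces.linear (*\<^sub>R) (*) f"
      by (simp add: Real_Vector_Spaces.linear_def)
    ultimately have "f \<in> continuous_dual (*\<^sub>R)" by (simp add: continuous_dual_def)
    then show "\<exists>f g. linear f \<and> (\<forall>z. f z \<le> norm z) \<and> f x = 1
        \<and> g \<in> continuous_dual (*\<^sub>R) \<and> (\<forall>z. g z = (0::real) \<longrightarrow> f z = (0::real))"
      using f x by (intro exI[of _ f] conjI) simp_all
  qed
next
  assume X: "banach_space_over scaleC" and inf: "infinite_dimensional scaleC"
    and convex: "strictly_convex_space TYPE('b)"
  show "\<exists>A. A \<subseteq> sphere (0::'b) 1 \<and> symmetrically_one_plus_separated A
            \<and> |A| =o density_character (weak_star_topology scaleC)"
  proof (rule separated_set_of_dual_norming[OF X inf convex])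
    fix x :: 'b assume x: "norm x = 1"
    obtain f :: "'b \<Rightarrow> real" where f: "linear f" "\<And>y. f y \<le> norm y" "f x = norm x"
      using norming_functional_exists by blast
    let ?g = "\<lambda>z. Complex (f z) (- f (scaleC \<i> z))"
    have "?g \<in> continuous_dual scaleC"
      by (rule complexified_functional_in_dual[OF X bounded_linear_of_norm_bound[OF f(1,2)]])
    moreover have "\<forall>z. ?g z = 0 \<longrightarrow> f z = 0" by (simp add: complex_eq_iff)
    ultimately show "\<exists>f g. linear f \<and> (\<forall>z. f z \<le> norm z) \<and> f x = 1
        \<and> g \<in> continuous_dual scaleC \<and> (\<forall>z. g z = 0 \<longrightarrow> f z = (0::real))"
      using f x by (intro exI[of _ f] exI[of _ ?g] conjI) simp_all
  qed
qed

end
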